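(* Let $(A,\{\cdot,\cdot\},\mu,\alpha,\beta)$ be a BiHom-Poisson algebra (respectively, a non-BiHom-commutative BiHom-Poisson algebra) and let $\alpha',\beta':A\to A$ be endomorphisms of $A$ such that any two of the maps $\alpha,\beta,\alpha',\beta'$ commute. Then $$A_{\alpha',\beta'}=(A,\ \{\cdot,\cdot\}_{\alpha',\beta'}=\{\cdot,\cdot\}\circ(\alpha'\otimes\beta'),\ \mu_{\alpha',\beta'}=\mu\circ(\alpha'\otimes\beta'),\ \alpha\alpha',\ \beta\beta')$$ is also a BiHom-Poisson algebra (respectively, a non-BiHom-commutative BiHom-Poisson algebra). Moreover, suppose that $(B,\{\cdot,\cdot\}',\mu',\gamma,\delta)$ is another BiHom-Poisson algebra and $\gamma',\delta'$ are endomorphisms of $B$ such that any two of the maps $\gamma,\delta,\gamma',\delta'$ commute, and let $B_{\gamma',\delta'}=(B,\{\cdot,\cdot\}'\circ(\gamma'\otimes\delta'),\mu'\circ(\gamma'\otimes\delta'),\gamma\gamma',\delta\delta')$. If $f:(A,\{\cdot,\cdot\},\mu,\alpha,\beta)\to(B,\{\cdot,\cdot\}',\mu',\gamma,\delta)$ is a morphism such that $f\circ\alpha'=\gamma'\circ f$ and $f\circ\beta'=\delta'\circ f$, then $f:A_{\alpha',\beta'}\to B_{\gamma',\delta'}$ is also a morphism.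
   Context: All vector spaces are over an algebraically closed field $\mathbb{K}$ of characteristic $0$. A BiHom-Poisson algebra is a tuple $(A,\{\cdot,\cdot\},\mu,\alpha,\beta)$ with $A$ a vector space, $\mu,\{\cdot,\cdot\}:A\times A\to A$ bilinear and $\alpha,\beta:A\to A$ linear with $\alpha\beta=\beta\alpha$, such that for all $x,y,z\in A$: (i) $\alpha$ and $\beta$ are multiplicative for both products, i.e. $\gamma(\mu(x,y))=\mu(\gamma(x),\gamma(y))$ and $\gamma(\{x,y\})=\{\gamma(x),\gamma(y)\}$ for $\gamma\in\{\alpha,\beta\}$; (ii) BiHom-commutativity: $\mu(\beta(x),\alpha(y))=\mu(\beta(y),\alpha(x))$; (iii) BiHom-associativity: $\mu(\mu(x,y),\beta(z))=\mu(\alpha(x),\mu(y,z))$; (iv) BiHom-skew-symmetry: $\{\beta(x),\alpha(y)\}=-\{\beta(y),\alpha(x)\}$; (v) BiHom-Jacobi identity: $\{\beta^2(x),\{\beta(y),\alpha(z)\}\}+\{\beta^2(y),\{\beta(z),\alpha(x)\}\}+\{\beta^2(z),\{\beta(x),\alpha(y)\}\}=0$; (vi) BiHom-Leibniz identity: $\{\alpha\beta(x),\mu(y,z)\}=\mu(\{\beta(x),y\},\beta(z))+\mu(\beta(y),\{\alpha(x),z\})$. A non-BiHom-commutative BiHom-Poisson algebra satisfies the same axioms except that (ii) is not assumed. A morphism $f:(A,\{\cdot,\cdot\},\mu,\alpha,\beta)\to(A',\{\cdot,\cdot\}',\mu',\alpha',\beta')$ is a linear map with $f(\{x,y\})=\{f(x),f(y)\}'$,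 $f(\mu(x,y))=\mu'(f(x),f(y))$, $f\alpha=\alpha' f$ and $f\beta=\beta' f$; an endomorphism of $A$ is a morphism $A\to A$. For a bilinear map $m$ and linear maps $p,q$, $(m\circ(p\otimes q))(x,y)=m(p(x),q(y))$. *)

theory Defs
  imports "HOL-Computational_Algebra.Polynomial"
begin

text \<open>The underlying vector space is the whole type \<open>'a\<close>, with scalar multiplication \<open>scal\<close>.\<close>

record ('k, 'a) bihom_data =
  scal :: "'k \<Rightarrow> 'a \<Rightarrow> 'a"
  bracket :: "'a \<Rightarrow> 'a \<Rightarrow> 'a"
  mu :: "'a \<Rightarrow> 'a \<Rightarrow> 'a"
  alpha :: "'a \<Rightarrow> 'a"
  beta :: "'a \<Rightarrow> 'a"

definition bilinear_op :: "('k::field \<Rightarrow> 'a::ab_group_add \<Rightarrow> 'a) \<Rightarrow> ('a \<Rightarrow> 'a \<Rightarrow> 'a) \<Rightarrow> bool" where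
  "bilinear_op s m \<longleftrightarrow>
     (\<forall>x. Vector_Spaces.linear s s (\<lambda>y. m x y)) \<and> (\<forall>y. Vector_Spaces.linear s s (\<lambda>x. m x y))"

definition multiplicative :: "('a \<Rightarrow> 'a) \<Rightarrow> ('a \<Rightarrow> 'a \<Rightarrow> 'a) \<Rightarrow> bool" where
  "multiplicative g m \<longleftrightarrow> (\<forall>x y. g (m x y) = m (g x) (g y))"

text \<open>The prefix \<open>nc\<close> stands for non-BiHom-commutative: BiHom-commutativity is not required,
  but it may hold.\<close>

locale nc_bihom_poisson = vector_space "scal A"
  for A :: "('k::{alg_closed_field, field_char_0}, 'a::ab_group_add) bihom_data" +
  assumes bracket_bilinear: "bilinear_op (scal A) (bracket A)"
    and mu_bilinear: "bilinear_op (scal A) (mu A)"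
    and alpha_linear: "Vector_Spaces.linear (scal A) (scal A) (alpha A)"
    and beta_linear: "Vector_Spaces.linear (scal A) (scal A) (beta A)"
    and alpha_beta: "alpha A \<circ> beta A = beta A \<circ> alpha A"
    and alpha_mu: "multiplicative (alpha A) (mu A)"
    and alpha_bracket: "multiplicative (alpha A) (bracket A)"
    and beta_mu: "multiplicative (beta A) (mu A)"
    and beta_bracket: "multiplicative (beta A) (bracket A)"
    and bihom_assoc: "\<And>x y z. mu A (mu A x y) (beta A z) = mu A (alpha A x) (mu A y z)"
    and bihom_skew: "\<And>x y. bracket A (beta A x) (alpha A y) = - bracket A (beta A y) (alpha A x)"
    and bihom_jacobi: "\<And>x y z.
        bracket A (beta A (beta A x)) (bracket A (beta A y) (alpha A z))
      + bracket A (beta A (beta A y)) (bracket A (beta A z) (alpha A x))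
      + bracket A (beta A (beta A z)) (bracket A (beta A x) (alpha A y)) = 0"
    and bihom_leibniz: "\<And>x y z.
        bracket A (alpha A (beta A x)) (mu A y z)
      = mu A (bracket A (beta A x) y) (beta A z) + mu A (beta A y) (bracket A (alpha A x) z)"

locale bihom_poisson = nc_bihom_poisson A
  for A :: "('k::{alg_closed_field, field_char_0}, 'a::ab_group_add) bihom_data" +
  assumes bihom_comm: "\<And>x y. mu A (beta A x) (alpha A y) = mu A (beta A y) (alpha A x)"

definition bihom_morphism ::
    "('k::field, 'a::ab_group_add) bihom_data \<Rightarrow> ('k, 'b::ab_group_add) bihom_data \<Rightarrow> ('a \<Rightarrow> 'b) \<Rightarrow> bool" where
  "bihom_morphism A B f \<longleftrightarrow>
     Vector_Spaces.linear (scal A) (scal B) f \<and>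
     (\<forall>x y. f (bracket A x y) = bracket B (f x) (f y)) \<and>
     (\<forall>x y. f (mu A x y) = mu B (f x) (f y)) \<and>
     f \<circ> alpha A = alpha B \<circ> f \<and>
     f \<circ> beta A = beta B \<circ> f"

abbreviation bihom_endomorphism ::
    "('k::field, 'a::ab_group_add) bihom_data \<Rightarrow> ('a \<Rightarrow> 'a) \<Rightarrow> bool" where
  "bihom_endomorphism A f \<equiv> bihom_morphism A A f"

definition pairwise_commute :: "('a \<Rightarrow> 'a) set \<Rightarrow> bool" where
  "pairwise_commute S \<longleftrightarrow> (\<forall>p\<in>S. \<forall>q\<in>S. p \<circ> q = q \<circ> p)"

text \<open>\<open>comp_tensor m p q\<close> is $m \circ (p \otimes q)$.\<close>

definition comp_tensor :: "('a \<Rightarrow> 'a \<Rightarrow> 'a) \<Rightarrow> ('a \<Rightarrow> 'a) \<Rightarrow> ('a \<Rightarrow> 'a) \<Rightarrow> 'a \<Rightarrow> 'a \<Rightarrow> 'a" where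
  "comp_tensor m p q = (\<lambda>x y. m (p x) (q y))"

definition twist :: "('k, 'a) bihom_data \<Rightarrow> ('a \<Rightarrow> 'a) \<Rightarrow> ('a \<Rightarrow> 'a) \<Rightarrow> ('k, 'a) bihom_data" where
  "twist A p q =
     \<lparr>scal = scal A,
      bracket = comp_tensor (bracket A) p q,
      mu = comp_tensor (mu A) p q,
      alpha = alpha A \<circ> p,
      beta = beta A \<circ> q\<rparr>"

end

theory Submission
  imports Defs
begin

text \<open>
  Write \<open>a, b\<close> for the structure maps, \<open>p, q\<close> for the two endomorphisms, and \<open>m\<close> for either
  product. Since \<open>p\<close> and \<open>q\<close> preserve both products and all four maps commute, every twisting map can
  be moved inward until it acts directly on a variable. After that, each axiom of the twisted algebra
  turns out to be the corresponding axiom of the original algebra evaluated at transformed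
  arguments. For example, BiHom-associativity of the twisted product at \<open>x, y, z\<close> reads
  \<open>m (m (p (p x)) (p (q y))) (b (q (q z))) = m (a (p (p x))) (m (p (q y)) (q (q z)))\<close>,
  which is associativity at \<open>p (p x)\<close>, \<open>p (q y)\<close>, \<open>q (q z)\<close>. The point to check is that in
  each axiom the powers of \<open>p\<close> and \<open>q\<close> attached to a given variable agree in all terms:
  \<^item> BiHom-associativity: \<open>p\<^sup>2\<close>, \<open>p q\<close>, \<open>q\<^sup>2\<close> on \<open>x\<close>, \<open>y\<close>, \<open>z\<close>;
  \<^item> BiHom-skew-symmetry and BiHom-commutativity: \<open>p q\<close> on both variables;
  \<^item> the BiHom-Jacobi identity: \<open>p q\<^sup>2\<close> on all three variables;
  \<^item> the BiHom-Leibniz identity: \<open>p\<^sup>2 q\<close>, \<open>p q\<close>, \<open>q\<^sup>2\<close> on \<open>x\<close>, \<open>y\<close>, \<open>z\<close>.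

  The statement about morphisms holds because a map that intertwines the structure maps and the
  twisting maps separately also intertwines their composites.
\<close>

lemma bilinear_op_comp_tensor:
  assumes "bilinear_op s m"
    and "Vector_Spaces.linear s s p" and "Vector_Spaces.linear s s q"
  shows "bilinear_op s (comp_tensor m p q)"
proof -
  have "Vector_Spaces.linear s s (m (p x) \<circ> q)" for x
    using assms unfolding bilinear_op_def by (intro Vector_Spaces.linear_compose) blast+
  moreover have "Vector_Spaces.linear s s ((\<lambda>x. m x (q y)) \<circ> p)" for y
    using assms unfolding bilinear_op_def by (intro Vector_Spaces.linear_compose) blast+
  ultimately show ?thesis
    by (simp add: bilinear_op_def comp_tensor_def o_def)
qed

lemma multiplicative_comp_tensor:
  assumes "multiplicative g m" and "g \<circ> p = p \<circ> g" and "g \<circ> q = q \<circ> g"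
  shows "multiplicative g (comp_tensor m p q)"
  using assms by (simp add: multiplicative_def comp_tensor_def fun_eq_iff)

lemma multiplicative_comp:
  assumes "multiplicative g m" and "multiplicative h m"
  shows "multiplicative (g \<circ> h) m"
  using assms by (simp add: multiplicative_def)

lemma bihom_morphismD:
  assumes "bihom_morphism A B f"
  shows "Vector_Spaces.linear (scal A) (scal B) f"
    and "f (bracket A x y) = bracket B (f x) (f y)"
    and "f (mu A x y) = mu B (f x) (f y)"
    and "f (alpha A x) = alpha B (f x)"
    and "f (beta A x) = beta B (f x)"
  using assms by (simp_all add: bihom_morphism_def fun_eq_iff)

lemma bihom_endomorphism_multiplicative:
  assumes "bihom_endomorphism A g"
  shows "multiplicative g (bracket A)" and "multiplicative g (mu A)"
  using bihom_morphismD[OF assms] by (simp_all add: multiplicative_def)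

lemma bihom_endomorphism_commute:
  assumes "bihom_endomorphism A g"
  shows "alpha A \<circ> g = g \<circ> alpha A" and "beta A \<circ> g = g \<circ> beta A"
  using assms by (simp_all add: bihom_morphism_def)

lemma (in nc_bihom_poisson) nc_bihom_poisson_twist:
  assumes p: "bihom_endomorphism A p" and q: "bihom_endomorphism A q"
    and pq: "p \<circ> q = q \<circ> p"
  shows "nc_bihom_poisson (twist A p q)"
proof -
  note lin = bihom_morphismD(1)[OF p] bihom_morphismD(1)[OF q]
  note comm = bihom_endomorphism_commute[OF p] bihom_endomorphism_commute[OF q]
  \<comment> \<open>These rules bring a composite of the four maps to the order \<open>alpha A\<close>, \<open>beta A\<close>, \<open>p\<close>, \<open>q\<close>
    from the outside in and distribute \<open>p\<close> and \<open>q\<close> over the products.\<close>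
  have ba: "beta A (alpha A x) = alpha A (beta A x)" and qp: "q (p x) = p (q x)" for x
    using alpha_beta pq by (simp_all add: fun_eq_iff)
  note normalize = ba qp bihom_morphismD(2-5)[OF p] bihom_morphismD(2-5)[OF q]
  have alpha_p: "multiplicative (alpha A \<circ> p) (comp_tensor m p q)"
    if "multiplicative (alpha A) m" "multiplicative p m" for m
    by (intro multiplicative_comp multiplicative_comp_tensor
        that comm pq comm[symmetric] pq[symmetric] refl)
  have beta_q: "multiplicative (beta A \<circ> q) (comp_tensor m p q)"
    if "multiplicative (beta A) m" "multiplicative q m" for m
    by (intro multiplicative_comp multiplicative_comp_tensor
        that comm pq comm[symmetric] pq[symmetric] refl)
  show ?thesis
  proof (intro nc_bihom_poisson.intro nc_bihom_poisson_axioms.intro)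
    show "vector_space (scal (twist A p q))"
      using vector_space_axioms by (simp add: twist_def)
    show "bilinear_op (scal (twist A p q)) (bracket (twist A p q))"
      "bilinear_op (scal (twist A p q)) (mu (twist A p q))"
      using bracket_bilinear mu_bilinear lin
      by (simp_all add: twist_def bilinear_op_comp_tensor)
    show "Vector_Spaces.linear (scal (twist A p q)) (scal (twist A p q)) (alpha (twist A p q))"
      "Vector_Spaces.linear (scal (twist A p q)) (scal (twist A p q)) (beta (twist A p q))"
      using Vector_Spaces.linear_compose[OF lin(1) alpha_linear]
        Vector_Spaces.linear_compose[OF lin(2) beta_linear]
      by (simp_all add: twist_def)
    show "alpha (twist A p q) \<circ> beta (twist A p q) = beta (twist A p q) \<circ> alpha (twist A p q)"
      by (simp add: twist_def fun_eq_iff normalize)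
    show "multiplicative (alpha (twist A p q)) (mu (twist A p q))"
      "multiplicative (alpha (twist A p q)) (bracket (twist A p q))"
      using alpha_p alpha_mu alpha_bracket bihom_endomorphism_multiplicative[OF p]
      by (simp_all add: twist_def)
    show "multiplicative (beta (twist A p q)) (mu (twist A p q))"
      "multiplicative (beta (twist A p q)) (bracket (twist A p q))"
      using beta_q beta_mu beta_bracket bihom_endomorphism_multiplicative[OF q]
      by (simp_all add: twist_def)
  next
    fix x y z
    show "mu (twist A p q) (mu (twist A p q) x y) (beta (twist A p q) z)
        = mu (twist A p q) (alpha (twist A p q) x) (mu (twist A p q) y z)"
      using bihom_assoc[of "p (p x)" "p (q y)" "q (q z)"]
      by (simp add: twist_def comp_tensor_def normalize)
    show "bracket (twist A p q) (beta (twist A p q) x) (alpha (twist A p q) y)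
        = - bracket (twist A p q) (beta (twist A p q) y) (alpha (twist A p q) x)"
      using bihom_skew[of "p (q x)" "p (q y)"]
      by (simp add: twist_def comp_tensor_def normalize)
    show "bracket (twist A p q) (beta (twist A p q) (beta (twist A p q) x))
          (bracket (twist A p q) (beta (twist A p q) y) (alpha (twist A p q) z))
      + bracket (twist A p q) (beta (twist A p q) (beta (twist A p q) y))
          (bracket (twist A p q) (beta (twist A p q) z) (alpha (twist A p q) x))
      + bracket (twist A p q) (beta (twist A p q) (beta (twist A p q) z))
          (bracket (twist A p q) (beta (twist A p q) x) (alpha (twist A p q) y)) = 0"
      using bihom_jacobi[of "p (q (q x))" "p (q (q y))" "p (q (q z))"]
      by (simp add: twist_def comp_tensor_def normalize)
    show "bracket (twist A p q) (alpha (twist A p q) (beta (twist A p q) x)) (mu (twist A p q) y z)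
      = mu (twist A p q) (bracket (twist A p q) (beta (twist A p q) x) y) (beta (twist A p q) z)
      + mu (twist A p q) (beta (twist A p q) y) (bracket (twist A p q) (alpha (twist A p q) x) z)"
      using bihom_leibniz[of "p (p (q x))" "p (q y)" "q (q z)"]
      by (simp add: twist_def comp_tensor_def normalize)
  qed
qed

lemma (in bihom_poisson) bihom_poisson_twist:
  assumes p: "bihom_endomorphism A p" and q: "bihom_endomorphism A q"
    and pq: "p \<circ> q = q \<circ> p"
  shows "bihom_poisson (twist A p q)"
proof (intro bihom_poisson.intro bihom_poisson_axioms.intro)
  show "nc_bihom_poisson (twist A p q)"
    by (rule nc_bihom_poisson_twist[OF assms])
next
  fix x y
  have qp: "q (p x) = p (q x)" for x
    using pq by (simp add: fun_eq_iff)
  show "mu (twist A p q) (beta (twist A p q) x) (alpha (twist A p q) y)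
      = mu (twist A p q) (beta (twist A p q) y) (alpha (twist A p q) x)"
    using bihom_comm[of "p (q x)" "p (q y)"]
    by (simp add: twist_def comp_tensor_def qp bihom_morphismD(4,5)[OF p] bihom_morphismD(4,5)[OF q])
qed

lemma bihom_morphism_twist:
  assumes "bihom_morphism A B f" and "f \<circ> p = p' \<circ> f" and "f \<circ> q = q' \<circ> f"
  shows "bihom_morphism (twist A p q) (twist B p' q') f"
  using assms by (simp add: bihom_morphism_def twist_def comp_tensor_def fun_eq_iff)

theorem theorem3p6:
  fixes A :: "('k::{alg_closed_field, field_char_0}, 'a::ab_group_add) bihom_data"
    and B :: "('k, 'b::ab_group_add) bihom_data"
    and \<alpha>' \<beta>' :: "'a \<Rightarrow> 'a"
    and \<gamma>' \<delta>' :: "'b \<Rightarrow> 'b"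
    and f :: "'a \<Rightarrow> 'b"
  assumes "bihom_endomorphism A \<alpha>'"
    and "bihom_endomorphism A \<beta>'"
    and "pairwise_commute {alpha A, beta A, \<alpha>', \<beta>'}"
  shows "(bihom_poisson A \<longrightarrow> bihom_poisson (twist A \<alpha>' \<beta>')) \<and>
    (nc_bihom_poisson A \<longrightarrow> nc_bihom_poisson (twist A \<alpha>' \<beta>')) \<and>
    ((bihom_poisson A \<and> bihom_poisson B \<or> nc_bihom_poisson A \<and> nc_bihom_poisson B) \<and>
      bihom_endomorphism B \<gamma>' \<and>
      bihom_endomorphism B \<delta>' \<and>
      pairwise_commute {alpha B, beta B, \<gamma>', \<delta>'} \<and>
      bihom_morphism A B f \<and>
      f \<circ> \<alpha>' = \<gamma>' \<circ> f \<and>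
      f \<circ> \<beta>' = \<delta>' \<circ> f
      \<longrightarrow> bihom_morphism (twist A \<alpha>' \<beta>') (twist B \<gamma>' \<delta>') f)"
proof -
  have comm: "\<alpha>' \<circ> \<beta>' = \<beta>' \<circ> \<alpha>'"
    using assms(3) unfolding pairwise_commute_def by blast
  show ?thesis
    using bihom_poisson.bihom_poisson_twist[OF _ assms(1,2) comm]
      nc_bihom_poisson.nc_bihom_poisson_twist[OF _ assms(1,2) comm]
      bihom_morphism_twist[of A B f \<alpha>' \<gamma>' \<beta>' \<delta>']
    by blast
qed

end
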